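(* Let $\mathcal{G}=\langle a,b,c\rangle\le \mathrm{Aut}(\{0,1\}^* )$ be the group of automorphisms of the binary rooted tree generated by $a=(1,1)\sigma$, $b=(a,c)$, $c=(b,1)$ (this is the iterated monodromy group $\mathrm{IMG}(z^2+\mathrm{i})$). Let $\zeta\approx 0.4786202932$ be the unique real root of the polynomial $Z^3-6Z^2+11Z-4$, and let $$\mu=\zeta\,\delta_a+(\zeta^2-4\zeta+2)\,\delta_b+(-1+3\zeta-\zeta^2)\,\delta_c .$$ Then $\mu$ is a nondegenerate probability measure on $\mathcal{G}$ (with all three coefficients positive) which is self-affine with respect to the letter $0$: there is $\alpha$ with $0<\alpha<1$ such that $$\mu|_0=\alpha\,\delta_e+(1-\alpha)\,\mu .$$ Moreover, $\mu$ is the only measure of the form $x\delta_a+y\delta_b+z\delta_c$ with $x,y,z>0$ and $x+y+z=1$ that is self-affine with respect to the letter $0$.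
   Context: Let $X=\{0,1\}$; the set $X^*$ of finite words over $X$ is the binary rooted tree. Every tree automorphism $g$ is written uniquely as $g=(g|_0,g|_1)\sigma_g$, where $\sigma_g\in\mathrm{Sym}(2)$ is the permutation of $X$ induced by $g$ and $g|_x\in\mathrm{Aut}(X^* )$ is determined by $g(xw)=\sigma_g(x)\,g|_x(w)$ for all $w\in X^*$. Products are defined by $gh(w)=h(g(w))$, so $gh=(g|_0h|_{\sigma_g(0)},\,g|_1h|_{\sigma_g(1)})\sigma_g\sigma_h$. The nontrivial element of $\mathrm{Sym}(2)$ is denoted $\sigma$; $e$ is the identity of $\mathcal{G}$ and $\delta_g$ is the point mass at $g$. A probability measure on $\mathcal{G}$ is nondegenerate if its support generates $\mathcal{G}$. Restriction $\mu|_x$ of a nondegenerate probability measure $\mu$ to a letter $x\in X$: let $h_1,h_2,\dots$ be independent with law $\mu$ and $g_n=h_1h_2\cdots h_n$. Then $(g_n|_x,g_n(x))$ is a Markov chain on $\mathcal{G}\times X$ (with $g_{n+1}|_x=g_n|_x\cdot h_{n+1}|_{g_n(x)}$), and $\mathcal{G}\times\{x\}$ is recurrent for it. The trace of this chain on $\mathcal{G}\times\{x\}$ is a random walk on $\mathcal{G}$, and $\mu|_x$ is its step distribution; equivalently, $\mu|_x$ is the law of $g_\tau|_x$, where $\tau=\min\{n\ge 1: g_n(x)=x\}$. A nondegenerate probability measure $\mu$ is self-affine with respect to $x$ if $\mu|_x=\alpha\delta_e+(1-\alpha)\mu$ for some $0<\alpha<1$. *)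

theory Defs
  imports "HOL-Probability.Probability" "HOL-Algebra.Generated_Groups"
begin

text \<open>
  Letters are booleans, with \<open>False\<close> for the letter \<open>0\<close> and \<open>True\<close> for \<open>1\<close>. The binary rooted
  tree has the words as vertices and an edge from each word \<open>v\<close> to \<open>v @ [x]\<close>. A bijection
  respecting this parent relation necessarily fixes the root.
\<close>

type_synonym word = "bool list"

definition tree_automorphism :: "(word \<Rightarrow> word) \<Rightarrow> bool" where
  "tree_automorphism g \<longleftrightarrow>
     bij g \<and> (\<forall>v w. (\<exists>x. w = v @ [x]) \<longleftrightarrow> (\<exists>x. g w = g v @ [x]))"

text \<open>Automorphisms act from the right: \<open>g \<otimes> h\<close> applies \<open>g\<close> first.\<close>

definition Aut_tree :: "(word \<Rightarrow> word) monoid" where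
  "Aut_tree = \<lparr>carrier = {g. tree_automorphism g}, mult = (\<lambda>g h. h \<circ> g), one = id\<rparr>"

text \<open>The permutation \<open>\<sigma>\<^sub>g\<close> of the letters and the sections \<open>g|\<^sub>x\<close>, determined by
  \<open>g (x # w) = root_perm g x # sect g x w\<close>.\<close>

definition root_perm :: "(word \<Rightarrow> word) \<Rightarrow> bool \<Rightarrow> bool" where
  "root_perm g x = hd (g [x])"

definition sect :: "(word \<Rightarrow> word) \<Rightarrow> bool \<Rightarrow> word \<Rightarrow> word" where
  "sect g x w = tl (g (x # w))"

text \<open>\<open>a = (1, 1)\<sigma>\<close>, \<open>b = (a, c)\<close>, \<open>c = (b, 1)\<close>\<close>

fun gen_a :: "word \<Rightarrow> word" where
  "gen_a [] = []"
| "gen_a (x # w) = (\<not> x) # w"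

fun gen_b :: "word \<Rightarrow> word" and gen_c :: "word \<Rightarrow> word" where
  "gen_b [] = []"
| "gen_b (False # w) = False # gen_a w"
| "gen_b (True # w) = True # gen_c w"
| "gen_c [] = []"
| "gen_c (False # w) = False # gen_b w"
| "gen_c (True # w) = True # w"

definition IMG :: "(word \<Rightarrow> word) monoid" where
  "IMG = Aut_tree\<lparr>carrier := generate Aut_tree {gen_a, gen_b, gen_c}\<rparr>"

definition prob_measure_on_IMG :: "(word \<Rightarrow> word) measure \<Rightarrow> bool" where
  "prob_measure_on_IMG \<mu> \<longleftrightarrow>
     prob_space \<mu> \<and> space \<mu> = carrier IMG \<and> sets \<mu> = Pow (carrier IMG)"

definition nondegenerate :: "(word \<Rightarrow> word) measure \<Rightarrow> bool" where
  "nondegenerate \<mu> \<longleftrightarrow> prob_measure_on_IMG \<mu> \<and>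
     generate IMG {g \<in> carrier IMG. measure \<mu> {g} > 0} = carrier IMG"

text \<open>A stream \<open>\<omega>\<close> lists the steps \<open>h\<^sub>1, h\<^sub>2, \<dots>\<close> of the walk, so \<open>h\<^sub>n\<close> is \<open>\<omega> !! (n - 1)\<close>;
  under \<open>stream_space \<mu>\<close> they are independent with law \<open>\<mu>\<close>.\<close>

primrec walk :: "(word \<Rightarrow> word) stream \<Rightarrow> nat \<Rightarrow> (word \<Rightarrow> word)" where
  "walk \<omega> 0 = \<one>\<^bsub>IMG\<^esub>"
| "walk \<omega> (Suc n) = walk \<omega> n \<otimes>\<^bsub>IMG\<^esub> (\<omega> !! n)"

text \<open>The first return time is finite almost surely for nondegenerate \<open>\<mu>\<close>; its value on the
  null set of paths that never return is irrelevant.\<close>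

definition return_time :: "bool \<Rightarrow> (word \<Rightarrow> word) stream \<Rightarrow> nat" where
  "return_time x \<omega> = (LEAST n. 1 \<le> n \<and> root_perm (walk \<omega> n) x = x)"

definition restriction ::
    "(word \<Rightarrow> word) measure \<Rightarrow> bool \<Rightarrow> (word \<Rightarrow> word) measure" where
  "restriction \<mu> x = distr (stream_space \<mu>) (count_space (carrier IMG))
     (\<lambda>\<omega>. sect (walk \<omega> (return_time x \<omega>)) x)"

text \<open>The identity \<open>\<mu>|\<^sub>x = \<alpha> \<delta>\<^sub>e + (1 - \<alpha>) \<mu>\<close> of measures on the discrete space \<open>IMG\<close>, written
  out event by event.\<close>

definition self_affine_with :: "real \<Rightarrow> (word \<Rightarrow> word) measure \<Rightarrow> bool \<Rightarrow> bool" where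
  "self_affine_with \<alpha> \<mu> x \<longleftrightarrow>
     (\<forall>A \<subseteq> carrier IMG. measure (restriction \<mu> x) A =
        \<alpha> * measure (return (count_space (carrier IMG)) \<one>\<^bsub>IMG\<^esub>) A + (1 - \<alpha>) * measure \<mu> A)"

definition self_affine :: "(word \<Rightarrow> word) measure \<Rightarrow> bool \<Rightarrow> bool" where
  "self_affine \<mu> x \<longleftrightarrow>
     nondegenerate \<mu> \<and> (\<exists>\<alpha>. 0 < \<alpha> \<and> \<alpha> < 1 \<and> self_affine_with \<alpha> \<mu> x)"

text \<open>The measure \<open>x \<delta>\<^sub>a + y \<delta>\<^sub>b + z \<delta>\<^sub>c\<close>, meant for nonnegative coefficients.\<close>

definition abc_measure :: "real \<Rightarrow> real \<Rightarrow> real \<Rightarrow> (word \<Rightarrow> word) measure" where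
  "abc_measure x y z = point_measure (carrier IMG)
     (\<lambda>g. ennreal (x * indicator {gen_a} g + y * indicator {gen_b} g + z * indicator {gen_c} g))"

definition zeta :: real where
  "zeta = (THE Z. Z ^ 3 - 6 * Z ^ 2 + 11 * Z - 4 = 0)"

end

(* From letter 0 the generators b and c return at once, contributing y at a and z at b. The
   generator a moves to letter 1, where b contributes a factor c, c contributes nothing, and a
   returns; since c is an involution, only the parity of the number of b's matters. Conditioning on
   the first step shows that this parity is odd with probability y / (x + 2 y), so
     mu|_0 = y delta_a + z delta_b + x y / (x + 2 y) delta_c + x (x + y) / (x + 2 y) delta_e.
   As a, b, c and e are distinct, self-affinity says y = r x, z = r y and x y / (x + 2 y) = r z with
   r = 1 - alpha; together with x + y + z = 1 this forces y (2 - x) = x and then the cubic for x. *)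

theory Submission
  imports Defs
begin

section \<open>The group\<close>

lemma group_Aut_tree: "group Aut_tree"
proof (rule groupI)
  fix g assume g: "g \<in> carrier Aut_tree"
  then have b: "bij g" by (simp add: Aut_tree_def tree_automorphism_def)
  have "tree_automorphism (inv_into UNIV g)"
    unfolding tree_automorphism_def
  proof (intro conjI allI)
    show "bij (inv_into UNIV g)" using b by (rule bij_imp_bij_inv)
    fix v w
    show "(\<exists>x. w = v @ [x]) \<longleftrightarrow> (\<exists>x. inv_into UNIV g w = inv_into UNIV g v @ [x])"
    proof -
      have "(\<exists>x. v' = u @ [x]) \<longleftrightarrow> (\<exists>x. g v' = g u @ [x])" for u v'
        using g by (simp add: Aut_tree_def tree_automorphism_def)
      then have "(\<exists>x. inv_into UNIV g w = inv_into UNIV g v @ [x]) \<longleftrightarrow>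
          (\<exists>x. g (inv_into UNIV g w) = g (inv_into UNIV g v) @ [x])" by blast
      then show ?thesis using bij_is_surj[OF b, THEN surj_f_inv_f] by simp
    qed
  qed
  then show "\<exists>h\<in>carrier Aut_tree. h \<otimes>\<^bsub>Aut_tree\<^esub> g = \<one>\<^bsub>Aut_tree\<^esub>"
    using b by (intro bexI[of _ "inv_into UNIV g"])
      (auto simp: Aut_tree_def fun_eq_iff bij_is_surj surj_f_inv_f)
qed (auto simp: Aut_tree_def tree_automorphism_def bij_comp)

text \<open>For an involution, the backward half of the edge condition is the forward half applied
  to the images.\<close>

lemma tree_automorphism_involution:
  assumes inv: "\<And>w. g (g w) = w" and ext: "\<And>v x. \<exists>y. g (v @ [x]) = g v @ [y]"
  shows "tree_automorphism g"
  unfolding tree_automorphism_def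
proof (intro conjI allI iffI)
  show "bij g" using inv by (rule involuntory_imp_bij)
  fix v w
  show "\<exists>x. g w = g v @ [x]" if "\<exists>x. w = v @ [x]" using that ext by auto
  show "\<exists>x. w = v @ [x]" if "\<exists>x. g w = g v @ [x]" using that ext inv by metis
qed

section \<open>The generators as involutive tree automorphisms\<close>

lemma gen_a_invol: "gen_a (gen_a w) = w"
  by (cases w) auto

lemma gen_bc_invol: "gen_b (gen_b w) = w" "gen_c (gen_c w) = w"
  by (induction w and w rule: gen_b_gen_c.induct) (auto simp: gen_a_invol)

lemma gen_bc_append:
  "\<exists>y. gen_b (v @ [x]) = gen_b v @ [y]" "\<exists>y. gen_c (v @ [x]) = gen_c v @ [y]"
proof (induction v and v rule: gen_b_gen_c.induct)
  case 1 show ?case by (cases x) auto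
next
  case (2 w) show ?case by (cases w) auto
next
  case 4 show ?case by (cases x) auto
qed auto

lemma tree_automorphism_gens:
  "tree_automorphism gen_a" "tree_automorphism gen_b" "tree_automorphism gen_c"
proof -
  have "\<exists>y. gen_a (v @ [x]) = gen_a v @ [y]" for v x by (cases v) auto
  then show "tree_automorphism gen_a" by (intro tree_automorphism_involution gen_a_invol)
qed (intro tree_automorphism_involution gen_bc_invol gen_bc_append)+

abbreviation gens :: "(word \<Rightarrow> word) set" where
  "gens \<equiv> {gen_a, gen_b, gen_c}"

lemma gens_subset: "gens \<subseteq> carrier Aut_tree"
  by (simp add: Aut_tree_def tree_automorphism_gens)

section \<open>The group generated by a, b, c\<close>

lemma IMG_mult [simp]: "g \<otimes>\<^bsub>IMG\<^esub> h = h \<circ> g" and IMG_one [simp]: "\<one>\<^bsub>IMG\<^esub> = id"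
  by (simp_all add: IMG_def Aut_tree_def)

lemma group_IMG: "group IMG"
  unfolding IMG_def
  by (intro subgroup.subgroup_is_group group.generate_is_subgroup group_Aut_tree gens_subset)

lemma IMG_closed: "id \<in> carrier IMG" "g \<in> carrier IMG \<Longrightarrow> h \<in> carrier IMG \<Longrightarrow> g \<circ> h \<in> carrier IMG"
  using group.is_monoid[OF group_IMG] monoid.one_closed[of IMG] monoid.m_closed[of IMG h g]
  by auto

lemma gens_IMG: "gen_a \<in> carrier IMG" "gen_b \<in> carrier IMG" "gen_c \<in> carrier IMG"
  by (auto simp: IMG_def intro: generate.incl)

text \<open>The carrier was generated inside \<open>Aut_tree\<close>, while nondegeneracy asks for
  generation inside \<open>IMG\<close>; in a subgroup containing the generators the two closures
  agree.\<close>

lemma generate_IMG_gens: "generate IMG gens = carrier IMG"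
proof -
  have "generate IMG gens = generate Aut_tree gens"
    unfolding IMG_def
    by (intro group.generate_consistent group.generate_is_subgroup group_Aut_tree gens_subset)
      (auto intro: generate.incl)
  then show ?thesis by (simp add: IMG_def)
qed

text \<open>The generators are their own inverses, so they generate the group already as a monoid
  and no case for inverses remains.\<close>

lemma IMG_induct [consumes 1, case_names id gen_a gen_b gen_c comp]:
  assumes "g \<in> carrier IMG"
    and "P id" "P gen_a" "P gen_b" "P gen_c"
    and comp: "\<And>g h. g \<in> carrier IMG \<Longrightarrow> h \<in> carrier IMG \<Longrightarrow> P g \<Longrightarrow> P h \<Longrightarrow> P (h \<circ> g)"
  shows "P g"
proof -
  have "inv\<^bsub>IMG\<^esub> s = s" if "s \<in> gens" for s
  proof (rule group.inv_equality[OF group_IMG])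
    show "s \<otimes>\<^bsub>IMG\<^esub> s = \<one>\<^bsub>IMG\<^esub>"
      using that by (auto simp: fun_eq_iff gen_a_invol gen_bc_invol)
  qed (use that gens_IMG in blast)+
  moreover have "g \<in> generate IMG gens" using assms(1) generate_IMG_gens by simp
  \<comment> \<open>Membership is carried along because the composition case demands it of both
    factors.\<close>
  then have "g \<in> carrier IMG \<and> P g" if "\<And>s. s \<in> gens \<Longrightarrow> inv\<^bsub>IMG\<^esub> s = s"
  proof (induction rule: generate.induct)
    case one
    show ?case using assms(2) IMG_closed(1) by (simp only: IMG_one)
  next
    case (incl s)
    then show ?case using assms(3-5) gens_IMG by blast
  next
    case (inv s)
    then have "inv\<^bsub>IMG\<^esub> s = s" by (rule that)
    then show ?case using inv assms(3-5) gens_IMG by auto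
  next
    case (eng g h)
    then show ?case using comp[of g h] IMG_closed(2)[of h g] by (simp only: IMG_mult)
  qed
  ultimately show ?thesis by blast
qed

text \<open>Every element is a finite word in three generators. Countability later lets
  measurability be checked one current position at a time.\<close>

lemma countable_IMG: "countable (carrier IMG)"
proof (rule countable_subset)
  show "countable ((\<lambda>ws. foldr (\<circ>) ws id) ` lists gens)"
    by (intro countable_image countable_lists countable_finite) simp
  show "carrier IMG \<subseteq> (\<lambda>ws. foldr (\<circ>) ws id) ` lists gens"
  proof
    fix g assume "g \<in> carrier IMG"
    then have "\<exists>ws\<in>lists gens. g = foldr (\<circ>) ws id"
    proof (induction rule: IMG_induct)
      case id show ?case by (intro bexI[of _ "[]"]) auto
    next
      case gen_a show ?case by (intro bexI[of _ "[gen_a]"]) auto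
    next
      case gen_b show ?case by (intro bexI[of _ "[gen_b]"]) auto
    next
      case gen_c show ?case by (intro bexI[of _ "[gen_c]"]) auto
    next
      case (comp g h)
      then obtain us vs where
        *: "us \<in> lists gens" "g = foldr (\<circ>) us id" "vs \<in> lists gens" "h = foldr (\<circ>) vs id"
        by blast
      have app: "foldr (\<circ>) (ws @ us) id = foldr (\<circ>) ws id \<circ> foldr (\<circ>) us id" for ws
        by (induction ws) (auto simp: comp_assoc)
      show ?case
      proof
        show "h \<circ> g = foldr (\<circ>) (vs @ us) id" by (simp only: * app)
        show "vs @ us \<in> lists gens" using * by simp
      qed
    qed
    then show "g \<in> (\<lambda>ws. foldr (\<circ>) ws id) ` lists gens" by blast
  qed
qed

lemma gens_distinct:
  "gen_a \<noteq> gen_b" "gen_a \<noteq> gen_c" "gen_b \<noteq> gen_c"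
  "gen_a \<noteq> id" "gen_b \<noteq> id" "gen_c \<noteq> id"
proof -
  \<comment> \<open>On the word 000 the generators a, b, c flip exactly the first, second and third
    letter respectively, so one word separates all four maps.\<close>
  let ?w = "[False, False, False]"
  have "gen_a ?w = [True, False, False]" "gen_b ?w = [False, True, False]"
    "gen_c ?w = [False, False, True]" by simp_all
  then show "gen_a \<noteq> gen_b" "gen_a \<noteq> gen_c" "gen_b \<noteq> gen_c"
    "gen_a \<noteq> id" "gen_b \<noteq> id" "gen_c \<noteq> id" by force+
qed

section \<open>Sections and the walk\<close>

text \<open>Self-similarity of the group. The induction runs on an existential form, which composes
  directly; \<open>root_perm\<close> and \<open>sect\<close>, defined through \<open>hd\<close> and
  \<open>tl\<close>, are identified with its witnesses only afterwards.\<close>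

lemma IMG_decomp:
  assumes "g \<in> carrier IMG"
  shows IMG_Cons: "g (u # w) = root_perm g u # sect g u w"
    and sect_IMG: "sect g u \<in> carrier IMG"
proof -
  have "\<forall>u. \<exists>v. \<exists>h\<in>carrier IMG. \<forall>w. g (u # w) = v # h w"
    using assms
  proof (induction rule: IMG_induct)
    case id
    show ?case by (intro allI exI bexI[OF _ IMG_closed(1)]) simp
  next
    case gen_a
    show ?case by (intro allI exI bexI[OF _ IMG_closed(1)]) simp
  next
    case gen_b
    have "\<exists>h\<in>carrier IMG. \<forall>w. gen_b (u # w) = u # h w" for u
      using gens_IMG by (intro bexI[of _ "if u then gen_c else gen_a"]) auto
    then show ?case by blast
  next
    case gen_c
    have "\<exists>h\<in>carrier IMG. \<forall>w. gen_c (u # w) = u # h w" for u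
      using gens_IMG IMG_closed(1) by (intro bexI[of _ "if u then id else gen_b"]) auto
    then show ?case by blast
  next
    case (comp g h)
    show ?case
    proof
      fix u
      from comp obtain v g' where g': "g' \<in> carrier IMG" "\<forall>w. g (u # w) = v # g' w" by blast
      from comp obtain v' h' where h': "h' \<in> carrier IMG" "\<forall>w. h (v # w) = v' # h' w" by blast
      show "\<exists>v. \<exists>k\<in>carrier IMG. \<forall>w. (h \<circ> g) (u # w) = v # k w"
        using g' h' IMG_closed(2) by (intro exI[of _ v'] bexI[of _ "h' \<circ> g'"]) auto
    qed
  qed
  then obtain v h where h: "h \<in> carrier IMG" "\<And>w. g (u # w) = v # h w" by blast
  then have "root_perm g u = v" "sect g u = h"
    by (auto simp: root_perm_def sect_def fun_eq_iff)
  with h show "g (u # w) = root_perm g u # sect g u w" "sect g u \<in> carrier IMG" by simp_all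
qed

lemma
  assumes "g \<in> carrier IMG" "h \<in> carrier IMG"
  shows root_perm_comp: "root_perm (h \<circ> g) u = root_perm h (root_perm g u)"
    and sect_comp: "sect (h \<circ> g) u = sect h (root_perm g u) \<circ> sect g u"
  using assms by (auto simp: root_perm_def[of "h \<circ> g"] sect_def[of "h \<circ> g"] fun_eq_iff IMG_Cons)

lemma root_perm_simps [simp]:
  "root_perm id u = u" "root_perm gen_a u = (\<not> u)" "root_perm gen_b u = u" "root_perm gen_c u = u"
  by (cases u; simp add: root_perm_def)+

lemma sect_simps [simp]:
  "sect id u = id" "sect gen_a u = id"
  "sect gen_b False = gen_a" "sect gen_b True = gen_c"
  "sect gen_c False = gen_b" "sect gen_c True = id"
  by (auto simp: sect_def fun_eq_iff)

section \<open>Walks split at their first step\<close>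

lemma walk_IMG: "\<omega> \<in> streams (carrier IMG) \<Longrightarrow> walk \<omega> n \<in> carrier IMG"
  by (induction n) (auto simp: IMG_closed snth_in)

text \<open>\<open>walk\<close> appends steps at the end, whereas first-step analysis removes one at
  the front. Products apply the left factor first, so that step is innermost.\<close>

lemma walk_SCons: "walk (h ## \<omega>) (Suc n) = walk \<omega> n \<circ> h"
proof (induction n)
  case (Suc n)
  have "walk (h ## \<omega>) (Suc (Suc n)) = (\<omega> !! n) \<circ> walk (h ## \<omega>) (Suc n)" by simp
  then show ?case unfolding Suc by (simp add: comp_assoc)
qed simp

text \<open>The random variable whose law is \<open>restriction\<close> at letter 0.\<close>

definition return_sect :: "(word \<Rightarrow> word) stream \<Rightarrow> word \<Rightarrow> word" where
  "return_sect \<omega> = sect (walk \<omega> (return_time False \<omega>)) False"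

definition reaches :: "(word \<Rightarrow> word) stream \<Rightarrow> bool" where
  "reaches \<omega> \<longleftrightarrow> (\<exists>n. \<not> root_perm (walk \<omega> n) True)"

text \<open>The section at letter 1 when the walk first carries 1 to 0. Off \<open>reaches\<close>
  the \<open>LEAST\<close> is unspecified, so values are computed only where \<open>reaches\<close>
  holds.\<close>

definition passage_sect :: "(word \<Rightarrow> word) stream \<Rightarrow> word \<Rightarrow> word" where
  "passage_sect \<omega> = sect (walk \<omega> (LEAST n. \<not> root_perm (walk \<omega> n) True)) True"

text \<open>b and c fix 0, so the return happens at time 1. The step a sends 0 to 1 with trivial
  section, leaving the passage from 1 to 0.\<close>

lemma return_sect_SCons:
  assumes \<omega>: "\<omega> \<in> streams (carrier IMG)"
  shows "return_sect (gen_b ## \<omega>) = gen_a" "return_sect (gen_c ## \<omega>) = gen_b"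
    and "reaches \<omega> \<Longrightarrow> return_sect (gen_a ## \<omega>) = passage_sect \<omega>"
proof -
  have "return_time False (s ## \<omega>) = Suc 0" if "\<not> root_perm s False" for s
    unfolding return_time_def using that by (intro Least_equality) auto
  then show "return_sect (gen_b ## \<omega>) = gen_a" "return_sect (gen_c ## \<omega>) = gen_b"
    by (simp_all add: return_sect_def)
  have rp: "root_perm (walk (gen_a ## \<omega>) (Suc m)) False = root_perm (walk \<omega> m) True" for m
    using walk_IMG[OF \<omega>] gens_IMG by (subst walk_SCons) (simp add: root_perm_comp)
  assume "reaches \<omega>"
  then obtain n where "\<not> root_perm (walk \<omega> n) True" unfolding reaches_def by blast
  \<comment> \<open>The bound \<open>1 \<le> n\<close> rules out time 0, so the minimum is the
    passage time of the remaining path shifted by one.\<close>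
  then have "return_time False (gen_a ## \<omega>) = Suc (LEAST n. \<not> root_perm (walk \<omega> n) True)"
    unfolding return_time_def by (subst Least_Suc[of _ "Suc n"]) (simp_all add: rp del: walk.simps)
  then show "return_sect (gen_a ## \<omega>) = passage_sect \<omega>"
    using walk_IMG[OF \<omega>] gens_IMG
    by (simp add: return_sect_def passage_sect_def walk_SCons sect_comp del: walk.simps)
qed

lemma passage_SCons_a:
  shows "reaches (gen_a ## \<omega>)" and "passage_sect (gen_a ## \<omega>) = id"
proof -
  have "\<not> root_perm (walk (gen_a ## \<omega>) (Suc 0)) True" by simp
  then show "reaches (gen_a ## \<omega>)" unfolding reaches_def by blast
  have "(LEAST n. \<not> root_perm (walk (gen_a ## \<omega>) n) True) = Suc 0"
    by (rule Least_equality) (auto simp: Suc_le_eq intro!: gr0I)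
  then show "passage_sect (gen_a ## \<omega>) = id" by (simp add: passage_sect_def)
qed

text \<open>A first step fixing 1 only delays the passage by one unit. Its section acts first and
  hence stands on the right of the composition.\<close>

lemma passage_SCons_fix:
  assumes \<omega>: "\<omega> \<in> streams (carrier IMG)" and s: "s \<in> carrier IMG" "root_perm s True"
  shows "reaches (s ## \<omega>) \<longleftrightarrow> reaches \<omega>"
    and "reaches \<omega> \<Longrightarrow> passage_sect (s ## \<omega>) = passage_sect \<omega> \<circ> sect s True"
proof -
  have rp: "root_perm (walk (s ## \<omega>) (Suc m)) True = root_perm (walk \<omega> m) True" for m
    using walk_IMG[OF \<omega>] s by (subst walk_SCons) (simp add: root_perm_comp)
  have "(\<exists>n. \<not> root_perm (walk (s ## \<omega>) n) True) \<longleftrightarrow>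
      (\<exists>n. \<not> root_perm (walk (s ## \<omega>) (Suc n)) True)"
    by (metis not0_implies_Suc root_perm_simps(1) walk.simps(1) IMG_one)
  then show "reaches (s ## \<omega>) \<longleftrightarrow> reaches \<omega>" unfolding reaches_def rp .
  assume "reaches \<omega>"
  then obtain n where "\<not> root_perm (walk \<omega> n) True" unfolding reaches_def by blast
  then have "(LEAST n. \<not> root_perm (walk (s ## \<omega>) n) True) =
      Suc (LEAST n. \<not> root_perm (walk \<omega> n) True)"
    by (subst Least_Suc[of _ "Suc n"]) (simp_all add: rp del: walk.simps(2))
  then show "passage_sect (s ## \<omega>) = passage_sect \<omega> \<circ> sect s True"
    using walk_IMG[OF \<omega>] s
    by (simp add: passage_sect_def walk_SCons sect_comp del: walk.simps)
qed

section \<open>The measures\<close>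

lemma space_abc [simp]: "space (abc_measure x y z) = carrier IMG"
  and sets_abc [simp]: "sets (abc_measure x y z) = Pow (carrier IMG)"
  by (simp_all add: abc_measure_def space_point_measure sets_point_measure)

text \<open>The density vanishes off the three distinct generators, so every integral over a step
  collapses to three terms.\<close>

lemma nn_integral_abc:
  assumes "x \<ge> 0" "y \<ge> 0" "z \<ge> 0"
  shows "(\<integral>\<^sup>+ g. f g \<partial>abc_measure x y z) =
    ennreal x * f gen_a + ennreal y * f gen_b + ennreal z * f gen_c"
proof -
  let ?w = "\<lambda>g. ennreal (x * indicator {gen_a} g + y * indicator {gen_b} g + z * indicator {gen_c} g)"
  have "(\<integral>\<^sup>+ g. f g \<partial>abc_measure x y z) = (\<integral>\<^sup>+ g. ?w g * f g \<partial>count_space (carrier IMG))"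
    unfolding abc_measure_def point_measure_def by (subst nn_integral_density) auto
  also have "\<dots> = (\<Sum>g\<in>gens. ?w g * f g)"
    using gens_IMG by (intro nn_integral_count_space') auto
  also have "\<dots> = ennreal x * f gen_a + ennreal y * f gen_b + ennreal z * f gen_c"
    using gens_distinct by (simp add: add.assoc)
  finally show ?thesis .
qed

context
  fixes x y z :: real
  assumes pos: "x > 0" "y > 0" "z > 0" and sum1: "x + y + z = 1"
begin

lemma measure_abc:
  assumes "A \<subseteq> carrier IMG"
  shows "measure (abc_measure x y z) A =
    x * indicator A gen_a + y * indicator A gen_b + z * indicator A gen_c"
proof -
  have "emeasure (abc_measure x y z) A = (\<integral>\<^sup>+ g. indicator A g \<partial>abc_measure x y z)"
    using assms by simp
  also have "\<dots> = ennreal (x * indicator A gen_a + y * indicator A gen_b + z * indicator A gen_c)"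
    using pos by (subst nn_integral_abc) (auto simp: indicator_def)
  finally show ?thesis using pos by (intro measure_eq_emeasure_eq_ennreal) simp_all
qed

lemma prob_space_abc: "prob_space (abc_measure x y z)"
proof
  have "emeasure (abc_measure x y z) (carrier IMG) =
      (\<integral>\<^sup>+ g. indicator (carrier IMG) g \<partial>abc_measure x y z)" by simp
  also have "\<dots> = ennreal x + ennreal y + ennreal z"
    using pos gens_IMG by (subst nn_integral_abc) auto
  also have "\<dots> = ennreal (x + y + z)" using pos by simp
  finally show "emeasure (abc_measure x y z) (space (abc_measure x y z)) = 1"
    by (simp add: sum1)
qed

lemma nondegenerate_abc: "nondegenerate (abc_measure x y z)"
proof -
  have "{g \<in> carrier IMG. measure (abc_measure x y z) {g} > 0} = gens"
    using pos gens_IMG gens_distinct by (auto simp: measure_abc indicator_def split: if_splits)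
  then show ?thesis
    by (simp add: nondegenerate_def prob_measure_on_IMG_def prob_space_abc generate_IMG_gens)
qed

section \<open>The path space and measurability of stopped sections\<close>

interpretation abc: prob_space "abc_measure x y z"
  by (rule prob_space_abc)

abbreviation paths :: "(word \<Rightarrow> word) stream measure" where
  "paths \<equiv> stream_space (abc_measure x y z)"

interpretation paths: prob_space paths
  by (rule abc.prob_space_stream_space)

lemma space_paths [simp]: "space paths = streams (carrier IMG)"
  by (simp add: space_stream_space)

text \<open>For a fixed current position the next one is a measurable function of the next step;
  there are only countably many positions to glue.\<close>

lemma walk_measurable: "(\<lambda>\<omega>. walk \<omega> n) \<in> paths \<rightarrow>\<^sub>M count_space (carrier IMG)"
proof (induction n)
  case 0 show ?case
    unfolding walk.simps IMG_one by (rule measurable_const) (use IMG_closed in \<open>simp add: id_def\<close>)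
next
  case (Suc n)
  have "(\<lambda>\<omega>. (\<omega> !! n) \<circ> g) \<in> paths \<rightarrow>\<^sub>M count_space (carrier IMG)" if "g \<in> carrier IMG" for g
  proof (rule measurable_compose[OF measurable_snth])
    show "(\<lambda>h. h \<circ> g) \<in> abc_measure x y z \<rightarrow>\<^sub>M count_space (carrier IMG)"
      using that by (auto simp: measurable_def IMG_closed)
  qed
  from measurable_compose_countable'[OF this Suc countable_IMG] show ?case
    by (simp only: walk.simps IMG_mult)
qed

lemma walk_fun_measurable: "(\<lambda>\<omega>. f (walk \<omega> n)) \<in> paths \<rightarrow>\<^sub>M count_space UNIV"
  by (rule measurable_compose[OF walk_measurable]) simp

text \<open>A random time with values in the naturals cuts the path space into countably many
  measurable pieces, on each of which the time is constant.\<close>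

lemma sect_walk_measurable:
  assumes [measurable]: "T \<in> paths \<rightarrow>\<^sub>M count_space UNIV"
  shows "(\<lambda>\<omega>. sect (walk \<omega> (T \<omega>)) u) \<in> paths \<rightarrow>\<^sub>M count_space (carrier IMG)"
proof (rule measurable_compose_countable[OF _ assms])
  fix n :: nat
  show "(\<lambda>\<omega>. sect (walk \<omega> n) u) \<in> paths \<rightarrow>\<^sub>M count_space (carrier IMG)"
    by (rule measurable_compose[OF walk_measurable]) (auto simp: sect_IMG)
qed

lemma return_sect_measurable: "return_sect \<in> paths \<rightarrow>\<^sub>M count_space (carrier IMG)"
  unfolding return_sect_def return_time_def
proof (intro sect_walk_measurable measurable_Least)
  fix n
  show "Measurable.pred paths (\<lambda>\<omega>. 1 \<le> n \<and> root_perm (walk \<omega> n) False = False)"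
    by (rule walk_fun_measurable)
qed

lemma passage_sect_measurable: "passage_sect \<in> paths \<rightarrow>\<^sub>M count_space (carrier IMG)"
  unfolding passage_sect_def
  by (rule sect_walk_measurable[OF measurable_Least]) (rule walk_fun_measurable)

lemma reaches_measurable: "Measurable.pred paths reaches"
  unfolding reaches_def
  by (rule pred_intros_countable(2)) (rule walk_fun_measurable)

section \<open>First-step analysis\<close>

lemma measure_first_step:
  assumes "A \<in> sets paths"
  shows "measure paths A = x * measure paths {\<omega>\<in>streams (carrier IMG). gen_a ## \<omega> \<in> A}
    + y * measure paths {\<omega>\<in>streams (carrier IMG). gen_b ## \<omega> \<in> A}
    + z * measure paths {\<omega>\<in>streams (carrier IMG). gen_c ## \<omega> \<in> A}"
    (is "_ = x * ?a + y * ?b + z * ?c")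
proof -
  \<comment> \<open>Conditioning on the first step: the tail of the stream is again distributed as
    \<open>paths\<close>.\<close>
  have "emeasure paths A =
      (\<integral>\<^sup>+ t. emeasure paths {\<omega>\<in>space paths. t ## \<omega> \<in> A} \<partial>abc_measure x y z)"
    by (rule abc.emeasure_stream_space[OF assms])
  also have "\<dots> = ennreal x * ennreal ?a + ennreal y * ennreal ?b + ennreal z * ennreal ?c"
    using pos by (subst nn_integral_abc) (auto simp: paths.emeasure_eq_measure)
  also have "\<dots> = ennreal (x * ?a + y * ?b + z * ?c)"
    using pos by (simp add: ennreal_mult)
  finally show ?thesis using pos by (intro measure_eq_emeasure_eq_ennreal) simp_all
qed

text \<open>Conjoining \<open>reaches\<close> keeps the unspecified value of
  \<open>passage_sect\<close> on paths that never pass out of the event.\<close>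

definition passage_event :: "(word \<Rightarrow> word) \<Rightarrow> (word \<Rightarrow> word) stream set" where
  "passage_event g = {\<omega>\<in>streams (carrier IMG). reaches \<omega> \<and> passage_sect \<omega> = g}"

lemma passage_event_sets: "g \<in> carrier IMG \<Longrightarrow> passage_event g \<in> sets paths"
proof -
  assume "g \<in> carrier IMG"
  then have "Measurable.pred paths (\<lambda>\<omega>. passage_sect \<omega> = g)"
    by (intro measurable_compose[OF passage_sect_measurable]) simp
  then have "Measurable.pred paths (\<lambda>\<omega>. reaches \<omega> \<and> passage_sect \<omega> = g)"
    using reaches_measurable by simp
  then show ?thesis by (simp add: passage_event_def pred_def)
qed

text \<open>Composition with the involution c can be moved across an equation; this is what turns a
  step b into a swap of the two parities.\<close>

lemma comp_gen_c_eq_iff: "h \<circ> gen_c = g \<longleftrightarrow> h = g \<circ> gen_c"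
  by (metis comp_assoc comp_id gen_bc_invol(2) fun_eq_iff comp_apply id_apply)

text \<open>First-step analysis. The two linear equations already force the probabilities to add up
  to 1, so that recurrence needs no separate argument.\<close>

lemma measure_passage_event:
  shows "measure paths (passage_event id) = (x + y) / (x + 2 * y)" (is "?E = _")
    and "measure paths (passage_event gen_c) = y / (x + 2 * y)" (is "?O = _")
proof -
  note fixb = passage_SCons_fix[OF _ gens_IMG(2)] and fixc = passage_SCons_fix[OF _ gens_IMG(3)]
  \<comment> \<open>An initial a ends the passage at once with trivial section, so the events become
    certain or impossible.\<close>
  have a: "{\<omega>\<in>streams (carrier IMG). gen_a ## \<omega> \<in> passage_event id} = space paths"
      "{\<omega>\<in>streams (carrier IMG). gen_a ## \<omega> \<in> passage_event gen_c} = {}"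
    using gens_IMG gens_distinct by (auto simp: passage_event_def passage_SCons_a)
  have "gen_c \<circ> gen_c = id" by (simp add: fun_eq_iff gen_bc_invol)
  \<comment> \<open>An initial b contributes a factor c and exchanges the two events; an initial c
    has trivial section at 1 and preserves them.\<close>
  then have b: "{\<omega>\<in>streams (carrier IMG). gen_b ## \<omega> \<in> passage_event id} = passage_event gen_c"
      "{\<omega>\<in>streams (carrier IMG). gen_b ## \<omega> \<in> passage_event gen_c} = passage_event id"
    using gens_IMG
    by (auto simp: passage_event_def fixb comp_gen_c_eq_iff)
  have c: "{\<omega>\<in>streams (carrier IMG). gen_c ## \<omega> \<in> passage_event g} = passage_event g" for g
    using gens_IMG by (auto simp: passage_event_def fixc)
  have E: "?E = x + y * ?O + z * ?E"
    using measure_first_step[OF passage_event_sets[OF IMG_closed(1)]]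
    by (simp add: a b c paths.prob_space[simplified])
  have O: "?O = y * ?E + z * ?O"
    using measure_first_step[OF passage_event_sets[OF gens_IMG(3)]] by (simp add: a b c)
  have z: "z = 1 - x - y" using sum1 by simp
  have O': "(x + y) * ?O = y * ?E" and E': "(x + y) * ?E = x + y * ?O"
    using O E unfolding z by (simp_all add: algebra_simps)
  \<comment> \<open>Elimination of \<open>?O\<close>: the determinant of the system is (x + y)^2 -
    y^2 = x (x + 2 y).\<close>
  have "x * (x + 2 * y) * ?E = (x + y) * ((x + y) * ?E) - y * (y * ?E)"
    by (simp add: algebra_simps)
  also have "\<dots> = (x + y) * (x + y * ?O) - y * ((x + y) * ?O)" by (simp add: O' E')
  also have "\<dots> = x * (x + y)" by (simp add: algebra_simps)
  finally have *: "(x + 2 * y) * ?E = x + y" using pos by simp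
  then show Eq: "?E = (x + y) / (x + 2 * y)" using pos by (simp add: field_simps)
  have "(x + y) * ((x + 2 * y) * ?O) = y * ((x + 2 * y) * ?E)"
    using O' by (metis mult.left_commute)
  then have "(x + 2 * y) * ?O = y" unfolding * using pos by simp
  then show "?O = y / (x + 2 * y)" using pos by (simp add: field_simps)
qed

lemma measure_restriction:
  assumes A: "A \<subseteq> carrier IMG"
  shows "measure (restriction (abc_measure x y z) False) A =
    x * ((x + y) / (x + 2 * y) * indicator A id + y / (x + 2 * y) * indicator A gen_c)
    + y * indicator A gen_a + z * indicator A gen_b"
proof -
  let ?R = "return_sect -` A \<inter> space paths"
  let ?E = "passage_event id" and ?O = "passage_event gen_c"
  let ?a = "{\<omega>\<in>streams (carrier IMG). gen_a ## \<omega> \<in> ?R}"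
  let ?AE = "if id \<in> A then ?E else {}" and ?AO = "if gen_c \<in> A then ?O else {}"
  have R: "?R \<in> sets paths" using A by (intro measurable_sets[OF return_sect_measurable]) auto
  have sets: "?E \<in> sets paths" "?O \<in> sets paths"
    by (simp_all add: passage_event_sets IMG_closed gens_IMG)
  have disj: "?E \<inter> ?O = {}" using gens_distinct by (auto simp: passage_event_def)
  \<comment> \<open>The two disjoint events have total mass 1, so almost every path passes to 0,
    with section e or c. The arbitrary values on the remaining paths lie in a null set.\<close>
  have "measure paths (?E \<union> ?O) = (x + y) / (x + 2 * y) + y / (x + 2 * y)"
    using sets disj by (simp add: paths.finite_measure_Union measure_passage_event)
  also have "\<dots> = 1" using pos by (simp flip: add_divide_distrib)
  finally have ae: "AE \<omega> in paths. \<omega> \<in> ?E \<union> ?O"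
    using paths.prob_eq_1[of "?E \<union> ?O"] sets by simp
  have "?a = (##) gen_a -` ?R \<inter> space paths" by auto
  also have "\<dots> \<in> sets paths"
    using gens_IMG R
    by (intro measurable_sets[OF measurable_Stream[OF measurable_const measurable_ident_sets[OF refl]]])
      auto
  finally have a_sets: "?a \<in> sets paths" .
  have "measure paths ?a = measure paths (?AE \<union> ?AO)"
  proof (rule paths.finite_measure_eq_AE)
    \<comment> \<open>On the two events the return section after an initial a is e or c, so
      membership depends only on which of these lies in \<open>A\<close>.\<close>
    show "AE \<omega> in paths. \<omega> \<in> ?a \<longleftrightarrow> \<omega> \<in> ?AE \<union> ?AO"
      using ae by eventually_elim
        (use gens_distinct gens_IMG in \<open>auto simp: passage_event_def return_sect_SCons split: if_splits\<close>)
  qed (use sets a_sets in auto)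
  also have "\<dots> = measure paths ?AE + measure paths ?AO"
    using sets disj by (intro paths.finite_measure_Union) auto
  finally have a: "measure paths ?a =
      (x + y) / (x + 2 * y) * indicator A id + y / (x + 2 * y) * indicator A gen_c"
    by (simp add: measure_passage_event indicator_def)
  have "{\<omega>\<in>streams (carrier IMG). gen_b ## \<omega> \<in> ?R} = (if gen_a \<in> A then space paths else {})"
    "{\<omega>\<in>streams (carrier IMG). gen_c ## \<omega> \<in> ?R} = (if gen_b \<in> A then space paths else {})"
    using gens_IMG by (auto simp: return_sect_SCons)
  then have bc: "measure paths {\<omega>\<in>streams (carrier IMG). gen_b ## \<omega> \<in> ?R} = indicator A gen_a"
    "measure paths {\<omega>\<in>streams (carrier IMG). gen_c ## \<omega> \<in> ?R} = indicator A gen_b"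
    using paths.prob_space by (simp_all add: indicator_def)
  have "measure (restriction (abc_measure x y z) False) A = measure paths ?R"
    unfolding restriction_def return_sect_def[symmetric]
    using A by (subst measure_distr[OF return_sect_measurable]) auto
  also have "\<dots> = x * measure paths ?a + y * indicator A gen_a + z * indicator A gen_b"
    by (subst measure_first_step[OF R]) (simp only: bc)
  finally show ?thesis unfolding a .
qed

section \<open>Self-affinity as a system of equations and its elimination\<close>

lemma self_affine_with_abc_iff:
  "self_affine_with \<alpha> (abc_measure x y z) False \<longleftrightarrow>
    x * (x + y) / (x + 2 * y) = \<alpha> \<and> x * y / (x + 2 * y) = (1 - \<alpha>) * z
    \<and> y = (1 - \<alpha>) * x \<and> z = (1 - \<alpha>) * y" (is "?L \<longleftrightarrow> ?R")
proof -
  have *: "self_affine_with \<alpha> (abc_measure x y z) False \<longleftrightarrow> (\<forall>A \<subseteq> carrier IMG.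
    x * ((x + y) / (x + 2 * y) * indicator A id + y / (x + 2 * y) * indicator A gen_c)
      + y * indicator A gen_a + z * indicator A gen_b =
    \<alpha> * indicator A id
      + (1 - \<alpha>) * (x * indicator A gen_a + y * indicator A gen_b + z * indicator A gen_c))"
    unfolding self_affine_with_def
    by (auto simp: measure_restriction measure_abc measure_return IMG_closed)
  show ?thesis
  proof
    assume ?L
    note eq = this[unfolded *, rule_format]
    show ?R
      \<comment> \<open>Both measures live on the four distinct elements e, a, b, c, so singletons
        read off the coefficients.\<close>
      using eq[of "{id}"] eq[of "{gen_a}"] eq[of "{gen_b}"] eq[of "{gen_c}"]
        gens_IMG IMG_closed(1) gens_distinct gens_distinct[symmetric] by simp
  next
    assume R: ?R
    then have e: "x * (x + y) / (x + 2 * y) = \<alpha>" and c: "x * y / (x + 2 * y) = (1 - \<alpha>) * z"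
      by blast+
    \<comment> \<open>The free factor \<open>p\<close> lets the equations, read from right to left,
      rewrite products with an indicator.\<close>
    have a: "y * p = (1 - \<alpha>) * x * p" and b: "z * p = (1 - \<alpha>) * y * p" for p
      using R by simp_all
    show ?L unfolding *
    proof (intro allI impI)
      fix A
      let ?i = "indicator A :: (word \<Rightarrow> word) \<Rightarrow> real"
      have "x * ((x + y) / (x + 2 * y) * ?i id + y / (x + 2 * y) * ?i gen_c)
          + y * ?i gen_a + z * ?i gen_b =
        x * (x + y) / (x + 2 * y) * ?i id + x * y / (x + 2 * y) * ?i gen_c
          + y * ?i gen_a + z * ?i gen_b"
        by (simp add: algebra_simps add_divide_distrib)
      also have "\<dots> = \<alpha> * ?i id + (1 - \<alpha>) * z * ?i gen_c
          + (1 - \<alpha>) * x * ?i gen_a + (1 - \<alpha>) * y * ?i gen_b"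
        by (simp only: e c a[symmetric] b[symmetric])
      also have "\<dots> = \<alpha> * ?i id + (1 - \<alpha>) * (x * ?i gen_a + y * ?i gen_b + z * ?i gen_c)"
        by (simp add: distrib_left)
      finally show "x * ((x + y) / (x + 2 * y) * ?i id + y / (x + 2 * y) * ?i gen_c)
          + y * ?i gen_a + z * ?i gen_b =
        \<alpha> * ?i id + (1 - \<alpha>) * (x * ?i gen_a + y * ?i gen_b + z * ?i gen_c)" .
    qed
  qed
qed

text \<open>Eliminating the common factor 1 - \<alpha> from the three equations leaves y^2 = x z and
  x^2 = z (x + 2 y); the condition on the sum then removes z.\<close>

lemma self_affine_imp_cubic:
  assumes "self_affine (abc_measure x y z) False"
  shows "x ^ 3 - 6 * x ^ 2 + 11 * x - 4 = 0"
    and "y = x ^ 2 - 4 * x + 2" and "z = - 1 + 3 * x - x ^ 2"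
proof -
  obtain \<alpha> where c: "x * y / (x + 2 * y) = (1 - \<alpha>) * z"
    and y: "y = (1 - \<alpha>) * x" and z: "z = (1 - \<alpha>) * y"
    using assms unfolding self_affine_def self_affine_with_abc_iff by blast
  have yy: "y * y = x * z" using y z by (metis mult.assoc mult.commute)
  have "x * y = (1 - \<alpha>) * z * (x + 2 * y)" using c pos by (simp add: field_simps)
  then have "x * (x * y) = y * (z * (x + 2 * y))" using y by (simp add: mult_ac)
  then have xx: "x * x = z * (x + 2 * y)" using pos by (simp add: mult_ac)
  have zz: "z = 1 - x - y" using sum1 by simp
  \<comment> \<open>With z = 1 - x - y the two relations read x^2 = x - x y - y^2 and x^2 = 2 y - 2
    x y - y^2; compare them.\<close>
  have y2: "y * (2 - x) = x" using yy xx unfolding zz by algebra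
  \<comment> \<open>Multiplying y^2 = x z by (2 - x)^2 allows each y (2 - x) to be replaced by x,
    which eliminates y; cancelling x leaves the cubic.\<close>
  have "y * (2 - x) * (y * (2 - x)) = x * (1 - x - y) * (2 - x) ^ 2" using yy unfolding zz by algebra
  then have "x * x = x * ((1 - x) * (2 - x) ^ 2 - y * (2 - x) * (2 - x))"
    unfolding y2 using y2 by algebra
  then have "x = (1 - x) * (2 - x) ^ 2 - x * (2 - x)" unfolding y2 using pos by simp
  then show cubic: "x ^ 3 - 6 * x ^ 2 + 11 * x - 4 = 0" by algebra
  have "x < 2" using pos sum1 by simp
  \<comment> \<open>Modulo the cubic both sides equal x, and 2 - x is positive, so it
    cancels.\<close>
  moreover have "(x ^ 2 - 4 * x + 2) * (2 - x) = y * (2 - x)" using cubic y2 by algebra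
  ultimately show y: "y = x ^ 2 - 4 * x + 2" by simp
  then show "z = - 1 + 3 * x - x ^ 2" using zz by simp
qed

end

section \<open>The cubic\<close>

text \<open>The cubic is not monotone on the whole line, but it increases below 1, where all its
  real roots lie.\<close>

lemma cubic_less:
  fixes Z W :: real
  assumes "Z < W" "W < 1"
  shows "Z ^ 3 - 6 * Z ^ 2 + 11 * Z - 4 < W ^ 3 - 6 * W ^ 2 + 11 * W - 4"
proof -
  \<comment> \<open>The cofactor of W - Z, expanded in the positive quantities 1 - W and 1 - Z, has
    only positive coefficients.\<close>
  have "W ^ 2 + W * Z + Z ^ 2 - 6 * W - 6 * Z + 11 =
      (1 - W) ^ 2 + (1 - Z) * (1 - W) + (1 - Z) ^ 2 + 3 * (1 - W) + 3 * (1 - Z) + 2" by algebra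
  also have "\<dots> > 0" using assms by (intro add_pos_pos mult_pos_pos) simp_all
  finally have "W ^ 2 + W * Z + Z ^ 2 - 6 * W - 6 * Z + 11 > 0" .
  then have "(W - Z) * (W ^ 2 + W * Z + Z ^ 2 - 6 * W - 6 * Z + 11) > 0" using assms by simp
  moreover have "(W - Z) * (W ^ 2 + W * Z + Z ^ 2 - 6 * W - 6 * Z + 11) =
      (W ^ 3 - 6 * W ^ 2 + 11 * W - 4) - (Z ^ 3 - 6 * Z ^ 2 + 11 * Z - 4)" by algebra
  ultimately show ?thesis by simp
qed

lemma cubic_mono:
  fixes Z W :: real
  assumes "Z \<le> W" "W < 1"
  shows "Z ^ 3 - 6 * Z ^ 2 + 11 * Z - 4 \<le> W ^ 3 - 6 * W ^ 2 + 11 * W - 4"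
  using cubic_less[of Z W] assms by (cases "Z = W") simp_all

lemma cubic_root_less_1:
  fixes Z :: real
  assumes "Z ^ 3 - 6 * Z ^ 2 + 11 * Z - 4 = 0"
  shows "Z < 1"
proof (rule ccontr)
  assume "\<not> Z < 1"
  \<comment> \<open>A rewriting of the cubic whose terms are visibly nonnegative for Z at least 1,
    with the constant 1 left over.\<close>
  then have "(Z - 1) * (Z - 3) ^ 2 + (Z - 2) ^ 2 + 1 > 0"
    by (intro add_nonneg_pos add_nonneg_nonneg mult_nonneg_nonneg) simp_all
  moreover have "(Z - 1) * (Z - 3) ^ 2 + (Z - 2) ^ 2 + 1 = Z ^ 3 - 6 * Z ^ 2 + 11 * Z - 4"
    by algebra
  ultimately show False using assms by simp
qed

text \<open>The endpoints lie 10^-10 on either side of the stated decimal; the cubic changes sign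
  between them, and monotonicity confines the root.\<close>

lemma cubic_root_bounds:
  fixes Z :: real
  assumes "Z ^ 3 - 6 * Z ^ 2 + 11 * Z - 4 = 0"
  shows "0.4786202931 < Z" and "Z < 0.4786202933"
proof -
  show "0.4786202931 < Z"
  proof (rule ccontr)
    assume "\<not> 0.4786202931 < Z"
    then have "Z ^ 3 - 6 * Z ^ 2 + 11 * Z - 4 \<le>
        0.4786202931 ^ 3 - 6 * 0.4786202931 ^ 2 + 11 * 0.4786202931 - 4"
      by (intro cubic_mono) simp_all
    also have "\<dots> < 0" by (simp add: power_divide)
    finally show False using assms by simp
  qed
  show "Z < 0.4786202933"
  proof (rule ccontr)
    assume "\<not> Z < 0.4786202933"
    have "(0 :: real) < 0.4786202933 ^ 3 - 6 * 0.4786202933 ^ 2 + 11 * 0.4786202933 - 4"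
      by (simp add: power_divide)
    also have "\<dots> \<le> Z ^ 3 - 6 * Z ^ 2 + 11 * Z - 4"
      using \<open>\<not> Z < 0.4786202933\<close> cubic_root_less_1[OF assms] by (intro cubic_mono) simp_all
    finally show False using assms by simp
  qed
qed

lemma cubic_ex1: "\<exists>!Z::real. Z ^ 3 - 6 * Z ^ 2 + 11 * Z - 4 = 0"
proof (rule ex_ex1I)
  have "\<exists>Z\<ge>0. Z \<le> 1 \<and> Z ^ 3 - 6 * Z ^ 2 + 11 * Z - 4 = (0::real)"
    by (rule IVT') (auto intro!: continuous_intros)
  then show "\<exists>Z::real. Z ^ 3 - 6 * Z ^ 2 + 11 * Z - 4 = 0" by blast
next
  fix Z W :: real
  assume "Z ^ 3 - 6 * Z ^ 2 + 11 * Z - 4 = 0" "W ^ 3 - 6 * W ^ 2 + 11 * W - 4 = 0"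
  then show "Z = W"
    using cubic_less[of Z W] cubic_less[of W Z] cubic_root_less_1[of Z] cubic_root_less_1[of W]
    by linarith
qed

section \<open>The measure with coefficients in zeta\<close>

lemma zeta_root: "zeta ^ 3 - 6 * zeta ^ 2 + 11 * zeta - 4 = 0"
  unfolding zeta_def by (rule theI'[OF cubic_ex1])

lemma zeta_coeffs_pos:
  "zeta > 0" "zeta ^ 2 - 4 * zeta + 2 > 0" "- 1 + 3 * zeta - zeta ^ 2 > 0"
proof -
  note bounds = cubic_root_bounds[OF zeta_root]
  show "zeta > 0" using bounds by simp
  \<comment> \<open>Two decimals suffice: y is about 0.31 and z about 0.21.\<close>
  have "zeta ^ 2 \<ge> 0.47 ^ 2" "zeta ^ 2 \<le> 0.48 ^ 2"
    using bounds by (intro power_mono; simp)+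
  then show "zeta ^ 2 - 4 * zeta + 2 > 0" "- 1 + 3 * zeta - zeta ^ 2 > 0"
    using bounds by (simp_all add: power_divide)
qed

lemma self_affine_zeta:
  "self_affine (abc_measure zeta (zeta ^ 2 - 4 * zeta + 2) (- 1 + 3 * zeta - zeta ^ 2)) False"
proof -
  let ?x = zeta and ?y = "zeta ^ 2 - 4 * zeta + 2" and ?z = "- 1 + 3 * zeta - zeta ^ 2"
  note pos = zeta_coeffs_pos and root = zeta_root
  have sum1: "?x + ?y + ?z = 1" by simp
  have lt: "zeta < 1" by (rule cubic_root_less_1[OF zeta_root])
  \<comment> \<open>Forced by y = (1 - \<alpha>) x and y (2 - x) = x, which give 1 - \<alpha> = 1 /
    (2 - x).\<close>
  define \<alpha> where "\<alpha> = (1 - zeta) / (2 - zeta)"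
  have \<alpha>: "0 < \<alpha>" "\<alpha> < 1" "1 - \<alpha> = 1 / (2 - zeta)"
    using lt by (simp_all add: \<alpha>_def field_simps)
  have d: "?x + 2 * ?y > 0" by (intro add_pos_pos[OF pos(1)] mult_pos_pos[OF _ pos(2)]) simp
  \<comment> \<open>The required equations with denominators cleared; in each, the two sides differ
    by a multiple of the cubic.\<close>
  have "?x * (?x + ?y) * (2 - zeta) = (1 - zeta) * (?x + 2 * ?y)"
    "?x * ?y * (2 - zeta) = ?z * (?x + 2 * ?y)"
    "?y * (2 - zeta) = ?x" "?z * (2 - zeta) = ?y"
    using root by algebra+
  then have "?x * (?x + ?y) / (?x + 2 * ?y) = \<alpha>" "?x * ?y / (?x + 2 * ?y) = (1 - \<alpha>) * ?z"
    "?y = (1 - \<alpha>) * ?x" "?z = (1 - \<alpha>) * ?y"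
    unfolding \<alpha>(3) unfolding \<alpha>_def using lt d
    by (simp_all only: frac_eq_eq times_divide_eq_left mult_1 eq_divide_eq split: if_splits) auto
  then have "self_affine_with \<alpha> (abc_measure ?x ?y ?z) False"
    using self_affine_with_abc_iff[OF pos sum1] by blast
  then show ?thesis
    unfolding self_affine_def using nondegenerate_abc[OF pos sum1] \<alpha>(1,2) by blast
qed

theorem mainTheorem4:
  fixes \<mu> :: "(word \<Rightarrow> word) measure"
  defines "\<mu> \<equiv> abc_measure zeta (zeta ^ 2 - 4 * zeta + 2) (- 1 + 3 * zeta - zeta ^ 2)"
  shows "(\<exists>!Z::real. Z ^ 3 - 6 * Z ^ 2 + 11 * Z - 4 = 0)
    \<and> zeta ^ 3 - 6 * zeta ^ 2 + 11 * zeta - 4 = 0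
    \<and> \<bar>zeta - 0.4786202932\<bar> < 1 / 10 ^ 10
    \<and> zeta > 0 \<and> zeta ^ 2 - 4 * zeta + 2 > 0 \<and> - 1 + 3 * zeta - zeta ^ 2 > 0
    \<and> nondegenerate \<mu>
    \<and> self_affine \<mu> False
    \<and> (\<forall>x y z. x > 0 \<and> y > 0 \<and> z > 0 \<and> x + y + z = 1 \<and> self_affine (abc_measure x y z) False
         \<longrightarrow> abc_measure x y z = \<mu>)"
proof (intro conjI allI impI cubic_ex1 zeta_root zeta_coeffs_pos)
  show "\<bar>zeta - 0.4786202932\<bar> < 1 / 10 ^ 10"
    unfolding abs_less_iff using cubic_root_bounds[OF zeta_root] by simp
  show "self_affine \<mu> False" unfolding \<mu>_def by (rule self_affine_zeta)
  then show "nondegenerate \<mu>" unfolding self_affine_def by blast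
next
  fix x y z :: real
  assume *: "x > 0 \<and> y > 0 \<and> z > 0 \<and> x + y + z = 1 \<and> self_affine (abc_measure x y z) False"
  have "x ^ 3 - 6 * x ^ 2 + 11 * x - 4 = 0" "y = x ^ 2 - 4 * x + 2" "z = - 1 + 3 * x - x ^ 2"
    using self_affine_imp_cubic[of x y z] * by blast+
  moreover from this have "x = zeta" using cubic_ex1 zeta_root by blast
  ultimately show "abc_measure x y z = \<mu>" unfolding \<mu>_def by simp
qed

end
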